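(* Let $f\in S_A$ be a monomial, i.e. $f=t^b$ with $b\in\mathbb{N}A$. Then $S_A[f^{-1}]=D_A\cdot f^{-1}$; that is, the localization $S_A[f^{-1}]$ is a cyclic left $D_A$-module generated by $f^{-1}$.
   Context: $\mathbb{K}$ is an algebraically closed field of characteristic $0$. $A$ is a $d\times n$ integer matrix with columns $a_1,\dots,a_n$ such that the group generated by the columns is $\mathbb{Z}A=\mathbb{Z}^d$. $\mathbb{N}A$ is the semigroup (monoid, containing $0$) generated by $a_1,\dots,a_n$, and $S_A=\mathbb{K}[\mathbb{N}A]=\mathbb{K}[t^{a_1},\dots,t^{a_n}]\subseteq\mathbb{K}[\mathbb{Z}^d]=\mathbb{K}[t_1^{\pm1},\dots,t_d^{\pm1}]$ is the associated toric algebra (not assumed normal). For a commutative $\mathbb{K}$-algebra $R$, put $D_0(R;\mathbb{K})=R$ and, for $i>0$, $D_i(R;\mathbb{K})=\{f\in\mathrm{Hom}_{\mathbb{K}}(R,R)\mid [f,r]\in D_{i-1}(R;\mathbb{K})\text{ for all }r\in R\}$; the ring of differential operators is $D(R;\mathbb{K})=\bigcup_j D_j(R;\mathbb{K})$. Write $D_A=D(S_A;\mathbb{K})$. If $M$ is a left $D(R;\mathbb{K})$-module and $f\in R$, the localization $M_f$ carries a unique left $D(R;\mathbb{K})$-module structure extending its $R$-module structure such that $M\to M_f$ is $D(R;\mathbb{K})$-linear; $S_A[f^{-1}]$ is regarded as a left $D_A$-module in this way. *)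

theory Defs
  imports
    "HOL-Analysis.Cartesian_Space"
    "HOL-Library.FuncSet"
    "HOL-Library.Poly_Mapping"
    "HOL-Computational_Algebra.Polynomial"
begin

text \<open>
  Throughout, a commutative algebra \<open>R\<close> over \<open>K\<close> is a subset of a commutative ring type,
  with \<open>K \<subseteq> R\<close> the set of scalars.  Maps defined on \<open>R\<close> are extensional functions
  (\<open>undefined\<close> off \<open>R\<close>), so that equality of maps is equality on \<open>R\<close>.
\<close>

subsection \<open>Differential operators\<close>

definition Hom_on :: "'a::comm_ring_1 set \<Rightarrow> 'a set \<Rightarrow> ('a \<Rightarrow> 'a) set" where
  "Hom_on K R = {\<phi> \<in> R \<rightarrow>\<^sub>E R.
     (\<forall>x\<in>R. \<forall>y\<in>R. \<phi> (x + y) = \<phi> x + \<phi> y) \<and>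
     (\<forall>c\<in>K. \<forall>x\<in>R. \<phi> (c * x) = c * \<phi> x)}"

definition mult_op :: "'a::comm_ring_1 set \<Rightarrow> 'a \<Rightarrow> 'a \<Rightarrow> 'a" where
  "mult_op R r = (\<lambda>x\<in>R. r * x)"

definition commutator_op :: "'a::comm_ring_1 set \<Rightarrow> ('a \<Rightarrow> 'a) \<Rightarrow> 'a \<Rightarrow> 'a \<Rightarrow> 'a" where
  "commutator_op R \<phi> r = (\<lambda>x\<in>R. \<phi> (r * x) - r * \<phi> x)"

primrec diff_ops_ord :: "'a::comm_ring_1 set \<Rightarrow> 'a set \<Rightarrow> nat \<Rightarrow> ('a \<Rightarrow> 'a) set" where
  "diff_ops_ord K R 0 = mult_op R ` R"
| "diff_ops_ord K R (Suc i) =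
     {\<phi> \<in> Hom_on K R. \<forall>r\<in>R. commutator_op R \<phi> r \<in> diff_ops_ord K R i}"

definition diff_ops :: "'a::comm_ring_1 set \<Rightarrow> 'a set \<Rightarrow> ('a \<Rightarrow> 'a) set" where
  "diff_ops K R = (\<Union>i. diff_ops_ord K R i)"

text \<open>
  \<open>act P u\<close> is the action of \<open>P\<close> on \<open>u \<in> M\<close>.  The ring \<open>diff_ops K R\<close> has pointwise addition,
  composition as multiplication and the identity of \<open>R\<close> as unit.
\<close>

definition left_D_module ::
  "'a::comm_ring_1 set \<Rightarrow> 'a set \<Rightarrow> 'a set \<Rightarrow> (('a \<Rightarrow> 'a) \<Rightarrow> 'a \<Rightarrow> 'a) \<Rightarrow> bool" where
  "left_D_module K R M act \<longleftrightarrow>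
     act \<in> diff_ops K R \<rightarrow>\<^sub>E (M \<rightarrow>\<^sub>E M) \<and>
     (\<forall>P\<in>diff_ops K R. \<forall>u\<in>M. \<forall>v\<in>M. act P (u + v) = act P u + act P v) \<and>
     (\<forall>P\<in>diff_ops K R. \<forall>Q\<in>diff_ops K R. \<forall>u\<in>M.
        act (\<lambda>x\<in>R. P x + Q x) u = act P u + act Q u) \<and>
     (\<forall>P\<in>diff_ops K R. \<forall>Q\<in>diff_ops K R. \<forall>u\<in>M. act (compose R P Q) u = act P (act Q u)) \<and>
     (\<forall>u\<in>M. act (\<lambda>x\<in>R. x) u = u)"

subsection \<open>Localization\<close>

text \<open>
  Here \<open>g\<close> is the inverse, in the ambient ring, of an element \<open>f \<in> R\<close>; the localization
  \<open>R[f\<^sup>-\<^sup>1]\<close> is the subring of all fractions \<open>r / f\<^sup>k\<close>, and \<open>R \<rightarrow> R[f\<^sup>-\<^sup>1]\<close> is the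
  inclusion (injective since \<open>f\<close> is a unit of the ambient ring).
\<close>

definition localization :: "'a::comm_ring_1 set \<Rightarrow> 'a \<Rightarrow> 'a set" where
  "localization R g = {r * g ^ k | r k. r \<in> R}"

text \<open>
  The unique left module structure on \<open>R[f\<^sup>-\<^sup>1]\<close> over the differential operators that extends its
  \<open>R\<close>-module structure and makes the inclusion of \<open>R\<close> (with its natural action \<open>P x\<close>) linear.
\<close>

definition loc_action :: "'a::comm_ring_1 set \<Rightarrow> 'a set \<Rightarrow> 'a \<Rightarrow> ('a \<Rightarrow> 'a) \<Rightarrow> 'a \<Rightarrow> 'a" where
  "loc_action K R g = (THE act.
     left_D_module K R (localization R g) act \<and>
     (\<forall>r\<in>R. \<forall>u\<in>localization R g. act (mult_op R r) u = r * u) \<and>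
     (\<forall>P\<in>diff_ops K R. \<forall>x\<in>R. act P x = P x))"

subsection \<open>Affine semigroups and toric algebras\<close>

definition NA :: "int ^ 'n ^ 'd \<Rightarrow> (int ^ 'd) set" where
  "NA A = {\<Sum>j\<in>UNIV. int (m j) *s column j A | m :: 'n \<Rightarrow> nat. True}"

definition ZA :: "int ^ 'n ^ 'd \<Rightarrow> (int ^ 'd) set" where
  "ZA A = {\<Sum>j\<in>UNIV. m j *s column j A | m :: 'n \<Rightarrow> int. True}"

text \<open>
  The group algebra of the lattice (Laurent polynomials) is the type of finitely supported
  functions on \<open>int ^ 'd\<close> with the convolution product.
\<close>

type_synonym ('k, 'd) laurent = "(int ^ 'd) \<Rightarrow>\<^sub>0 'k"

definition tpow :: "int ^ 'd \<Rightarrow> ('k::comm_ring_1, 'd) laurent" where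
  "tpow b = Poly_Mapping.single b 1"

lemma tpow_inverse: "tpow b * tpow (- b) = 1"
  by (simp add: tpow_def mult_single)

definition scalars :: "('k::comm_ring_1, 'd::finite) laurent set" where
  "scalars = range (Poly_Mapping.single 0)"

definition toric_algebra :: "int ^ 'n ^ 'd \<Rightarrow> ('k::comm_ring_1, 'd) laurent set" where
  "toric_algebra A = {p. Poly_Mapping.keys p \<subseteq> NA A}"

end

theory Submission
  imports Defs
begin

text \<open>
  Multiplication by \<open>r \<in> S\<close> is a differential operator, so it suffices to produce, for every
  \<open>k\<close>, an operator \<open>P \<in> D\<close> sending \<open>t\<^sup>-\<^sup>b\<close> to a nonzero multiple of \<open>t\<^sup>-\<^sup>b\<close> times
  \<open>t\<close> to the power \<open>-k b\<close>.  Such a \<open>P\<close> is sought among the homogeneous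
  operators: a polynomial function \<open>p\<close> on the lattice defines the operator
  \<open>t\<^sup>a \<mapsto> p(a) t\<^sup>a\<^sup>-\<^sup>k\<^sup>b\<close> of the Laurent ring, which preserves \<open>S\<close> as soon as \<open>p\<close> vanishes on
  \<open>\<Omega> = {a \<in> NA. a - k b \<notin> NA}\<close>, and which acts on \<open>t\<^sup>-\<^sup>b\<close> through the scalar \<open>p(-b)\<close>.  So everything
  comes down to separating \<open>-b\<close> from \<open>\<Omega>\<close> by a polynomial (\<open>separating_symbol\<close>).

  Write the elements of \<open>NA\<close> as combinations of the columns \<open>a\<^sub>j\<close> with exponent vectors
  \<open>m \<in> \<nat>\<^sup>n\<close>.  The exponents of elements outside \<open>\<Omega>\<close> form an up-set, and the complement of an
  up-set is a finite union of boxes, in each of which the coordinates in some set \<open>J\<close> are free and the others are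
  fixed (\<open>box_minus_upset_finite_union\<close>).  Such a box is mapped to a set \<open>c\<^sub>0 + \<nat>A\<^sub>J\<close> contained in
  \<open>\<Omega>\<close>.  If \<open>-b\<close> belonged to the rational affine span \<open>c\<^sub>0 + \<rat>A\<^sub>J\<close>, then clearing denominators would
  express a positive multiple of \<open>b + c\<^sub>0\<close> as an integral combination of the \<open>a\<^sub>j\<close>, \<open>j \<in> J\<close>; adding
  a large element of \<open>\<nat>A\<^sub>J\<close> then gives a point of \<open>c\<^sub>0 + \<nat>A\<^sub>J\<close> from which \<open>k b\<close> can be
  subtracted inside \<open>NA\<close>, contrary to the definition of \<open>\<Omega>\<close>.  Hence an affine linear form vanishes on
  the image of the box but not at \<open>-b\<close> (\<open>box_avoiding_affine_form\<close>), and \<open>p\<close> is the product of these forms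
  over the finitely many boxes.

  The action on the localization has to be pinned down first, since it is given by a definite description.
  A differential operator from the localization to an ambient ring is determined by its values on \<open>R\<close>
  (\<open>extension_unique\<close>), and every differential operator of \<open>R\<close> extends
  (\<open>extension_exists\<close>); both go by induction on the order.  In consequence the
  action of \<open>P\<close> agrees with any differential operator of the ambient ring that restricts to \<open>P\<close>
  (\<open>loc_action_eq\<close>), and in the toric case the operators above can be evaluated on \<open>t\<^sup>-\<^sup>b\<close> directly.
\<close>

section \<open>Operators with nilpotent commutators\<close>

definition bracket :: "('a::comm_ring_1 \<Rightarrow> 'a) \<Rightarrow> 'a \<Rightarrow> 'a \<Rightarrow> 'a" where
  "bracket \<phi> r = (\<lambda>x. \<phi> (r * x) - r * \<phi> x)"

text \<open>
  The order is shifted by one against \<open>diff_ops_ord\<close>, so that the recursion starts from the zero operator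
  and the same notion makes sense for maps from an \<open>R\<close>-module \<open>M\<close> to the ambient ring, where
  multiplications by elements of \<open>R\<close> would not be the only operators commuting with \<open>R\<close>.
\<close>

primrec order_below :: "'a::comm_ring_1 set \<Rightarrow> 'a set \<Rightarrow> nat \<Rightarrow> ('a \<Rightarrow> 'a) \<Rightarrow> bool" where
  "order_below R M 0 \<phi> \<longleftrightarrow> (\<forall>x\<in>M. \<phi> x = 0)"
| "order_below R M (Suc i) \<phi> \<longleftrightarrow> (\<forall>r\<in>R. order_below R M i (bracket \<phi> r))"

lemma order_below_cong:
  assumes "\<And>r x. r \<in> R \<Longrightarrow> x \<in> M \<Longrightarrow> r * x \<in> M"
    and "\<And>x. x \<in> M \<Longrightarrow> \<phi> x = \<psi> x"
  shows "order_below R M i \<phi> \<longleftrightarrow> order_below R M i \<psi>"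
  using assms(2)
proof (induction i arbitrary: \<phi> \<psi>)
  case (Suc i)
  have "order_below R M i (bracket \<phi> r) \<longleftrightarrow> order_below R M i (bracket \<psi> r)" if "r \<in> R" for r
    by (rule Suc.IH) (simp add: bracket_def Suc.prems assms(1) that)
  then show ?case by simp
qed simp

lemma order_below_subset:
  assumes "order_below R M i \<phi>" and "R' \<subseteq> R" and "M' \<subseteq> M"
  shows "order_below R' M' i \<phi>"
  using assms(1) by (induction i arbitrary: \<phi>) (use assms(2,3) in auto)

lemma order_below_zero: "order_below R M i (\<lambda>x. 0)"
  by (induction i) (simp_all add: bracket_def)

lemma order_below_Suc:
  assumes "\<And>r x. r \<in> R \<Longrightarrow> x \<in> M \<Longrightarrow> r * x \<in> M"
    and "order_below R M i \<phi>"
  shows "order_below R M (Suc i) \<phi>"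
  using assms(2)
proof (induction i arbitrary: \<phi>)
  case 0
  then show ?case by (simp add: bracket_def assms(1))
next
  case (Suc i)
  then show ?case by simp
qed

lemma order_below_mono:
  assumes "\<And>r x. r \<in> R \<Longrightarrow> x \<in> M \<Longrightarrow> r * x \<in> M"
    and "i \<le> j" and "order_below R M i \<phi>"
  shows "order_below R M j \<phi>"
  using assms(2,3)
  by (induction j rule: dec_induct) (auto intro: order_below_Suc[OF assms(1)] simp del: order_below.simps)

lemma order_below_add:
  assumes "order_below R M i \<phi>" and "order_below R M i \<psi>"
  shows "order_below R M i (\<lambda>x. \<phi> x + \<psi> x)"
  using assms
proof (induction i arbitrary: \<phi> \<psi>)
  case (Suc i)
  have "order_below R M i (bracket (\<lambda>x. \<phi> x + \<psi> x) r)" if "r \<in> R" for r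
  proof -
    have "bracket (\<lambda>x. \<phi> x + \<psi> x) r = (\<lambda>x. bracket \<phi> r x + bracket \<psi> r x)"
      by (simp add: bracket_def fun_eq_iff algebra_simps)
    then show ?thesis using Suc that by simp
  qed
  then show ?case by simp
qed simp

lemma order_below_diff:
  assumes "order_below R M i \<phi>" and "order_below R M i \<psi>"
  shows "order_below R M i (\<lambda>x. \<phi> x - \<psi> x)"
  using assms
proof (induction i arbitrary: \<phi> \<psi>)
  case (Suc i)
  have "order_below R M i (bracket (\<lambda>x. \<phi> x - \<psi> x) r)" if "r \<in> R" for r
  proof -
    have "bracket (\<lambda>x. \<phi> x - \<psi> x) r = (\<lambda>x. bracket \<phi> r x - bracket \<psi> r x)"
      by (simp add: bracket_def fun_eq_iff algebra_simps)
    then show ?thesis using Suc that by simp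
  qed
  then show ?case by simp
qed simp

lemma order_below_mult: "order_below R M (Suc 0) (\<lambda>x. a * x)"
  by (simp add: bracket_def mult.left_commute)

definition additive_endo :: "'a::comm_ring_1 set \<Rightarrow> ('a \<Rightarrow> 'a) \<Rightarrow> bool" where
  "additive_endo M \<phi> \<longleftrightarrow> \<phi> ` M \<subseteq> M \<and> (\<forall>x\<in>M. \<forall>y\<in>M. \<phi> (x + y) = \<phi> x + \<phi> y)"

lemma additive_endo_bracket:
  assumes "additive_endo M \<phi>" and "\<And>x. x \<in> M \<Longrightarrow> r * x \<in> M"
    and "\<And>x y. x \<in> M \<Longrightarrow> y \<in> M \<Longrightarrow> x - y \<in> M"
  shows "additive_endo M (bracket \<phi> r)"
  using assms unfolding additive_endo_def bracket_def
  by (simp add: image_subset_iff distrib_left)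

text \<open>By the Leibniz rule \<open>[\<phi>\<psi>, r] = [\<phi>, r]\<psi> + \<phi>[\<psi>, r]\<close>, each summand of the bracket has one of the
  two orders lowered, so that induction on \<open>i + j\<close> applies.\<close>

lemma order_below_compose:
  assumes "\<And>r x. r \<in> R \<Longrightarrow> x \<in> M \<Longrightarrow> r * x \<in> M"
    and "\<And>x y. x \<in> M \<Longrightarrow> y \<in> M \<Longrightarrow> x - y \<in> M"
    and "additive_endo M \<phi>" and "additive_endo M \<psi>"
    and "order_below R M i \<phi>" and "order_below R M j \<psi>"
  shows "order_below R M (i + j) (\<lambda>x. \<phi> (\<psi> x))"
  using assms(3-6)
proof (induction "i + j" arbitrary: i j \<phi> \<psi> rule: less_induct)
  case less
  have into: "\<psi> x \<in> M" if "x \<in> M" for x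
    using less.prems(2) that by (auto simp: additive_endo_def)
  have cong: "order_below R M n \<alpha>" if "order_below R M n \<beta>" "\<And>x. x \<in> M \<Longrightarrow> \<alpha> x = \<beta> x" for n \<alpha> \<beta>
    using order_below_cong[of R M \<alpha> \<beta> n] assms(1) that by blast
  consider "i = 0" | "j = 0" | i' j' where "i = Suc i'" "j = Suc j'"
    by (cases i; cases j) auto
  then show ?case
  proof cases
    case 1
    then show ?thesis
      using less.prems(3) into by (intro cong[OF order_below_zero]) auto
  next
    case 2
    have "\<phi> 0 = 0" if "x \<in> M" for x
    proof -
      have "0 \<in> M" using assms(2)[OF that that] by simp
      then have "\<phi> (0 + 0) = \<phi> 0 + \<phi> 0"
        using less.prems(1) unfolding additive_endo_def by blast
      then show ?thesis by simp
    qed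
    then show ?thesis
      using less.prems(4) 2 by (intro cong[OF order_below_zero]) auto
  next
    case 3
    have "order_below R M (i' + j) (bracket (\<lambda>x. \<phi> (\<psi> x)) r)" if r: "r \<in> R" for r
    proof (rule cong)
      have "order_below R M (i' + j) (\<lambda>x. bracket \<phi> r (\<psi> x))"
        by (rule less.hyps)
          (use 3 less.prems r assms(1,2) in \<open>auto intro!: additive_endo_bracket\<close>)
      moreover have "order_below R M (i + j') (\<lambda>x. \<phi> (bracket \<psi> r x))"
        by (rule less.hyps)
          (use 3 less.prems r assms(1,2) in \<open>auto intro!: additive_endo_bracket\<close>)
      moreover have "i + j' = i' + j" using 3 by simp
      ultimately show "order_below R M (i' + j) (\<lambda>x. bracket \<phi> r (\<psi> x) + \<phi> (bracket \<psi> r x))"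
        by (metis order_below_add)
      show "bracket (\<lambda>x. \<phi> (\<psi> x)) r x = bracket \<phi> r (\<psi> x) + \<phi> (bracket \<psi> r x)" if x: "x \<in> M" for x
      proof -
        have "bracket \<psi> r x \<in> M"
          using x r assms(1,2) into by (auto simp: bracket_def)
        then have "\<phi> (r * \<psi> x + bracket \<psi> r x) = \<phi> (r * \<psi> x) + \<phi> (bracket \<psi> r x)"
          using less.prems(1) into x r assms(1) by (simp add: additive_endo_def)
        then show ?thesis by (simp add: bracket_def)
      qed
    qed
    then show ?thesis using 3 by simp
  qed
qed

section \<open>Extending operators to a localization\<close>

text \<open>
  The inverse \<open>g\<close> of \<open>f\<close> lives in the ambient ring, in which \<open>f\<close> is therefore a nonzerodivisor.
\<close>

locale localized_algebra =
  fixes K R :: "'a::comm_ring_1 set" and f g :: 'a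
  assumes fg: "f * g = 1"
    and f_in: "f \<in> R" and one_in: "1 \<in> R"
    and diff_in: "x \<in> R \<Longrightarrow> y \<in> R \<Longrightarrow> x - y \<in> R"
    and mult_in: "x \<in> R \<Longrightarrow> y \<in> R \<Longrightarrow> x * y \<in> R"
    and K_sub: "K \<subseteq> R"
begin

abbreviation "M \<equiv> localization R g"

lemma zero_in: "0 \<in> R" using diff_in[OF one_in one_in] by simp

lemma add_in: "x \<in> R \<Longrightarrow> y \<in> R \<Longrightarrow> x + y \<in> R"
  using diff_in[of x "0 - y"] diff_in[of 0 y] zero_in by simp

lemma f_pow_in: "f ^ k \<in> R"
  by (induction k) (auto intro: one_in f_in mult_in)

lemma f_pow_g_pow: "f ^ k * g ^ k = 1"
  by (metis fg power_mult_distrib power_one)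

lemma f_pow_cancel: "f ^ k * x = f ^ k * y \<Longrightarrow> x = y"
  by (metis f_pow_g_pow mult.assoc mult.commute mult_1)

text \<open>Membership through a denominator, not through a chosen numerator: powers of \<open>f\<close> can be
  increased freely, so finitely many elements have a common \<open>k\<close>.\<close>

lemma mem_localization_iff: "u \<in> M \<longleftrightarrow> (\<exists>k. f ^ k * u \<in> R)"
proof
  assume "u \<in> M"
  then obtain r k where "r \<in> R" "u = r * g ^ k" by (auto simp: localization_def)
  then have "f ^ k * u = r" using f_pow_g_pow[of k] by (simp add: mult.left_commute)
  with \<open>r \<in> R\<close> show "\<exists>k. f ^ k * u \<in> R" by blast
next
  assume "\<exists>k. f ^ k * u \<in> R"
  then obtain k where "f ^ k * u \<in> R" by blast
  moreover have "u = f ^ k * u * g ^ k"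
    using f_pow_g_pow[of k] by (simp add: mult.commute mult.left_commute)
  ultimately show "u \<in> M" unfolding localization_def by blast
qed

lemma f_pow_mono:
  assumes "f ^ k * u \<in> R" and "k \<le> l"
  shows "f ^ l * u \<in> R"
proof -
  have "f ^ l * u = f ^ (l - k) * (f ^ k * u)"
    using assms(2) by (simp add: mult.assoc[symmetric] power_add[symmetric])
  then show ?thesis using assms(1) f_pow_in mult_in by simp
qed

lemma R_sub_localization: "R \<subseteq> M"
proof
  show "x \<in> M" if "x \<in> R" for x
    using that by (subst mem_localization_iff, intro exI[of _ 0]) simp
qed

lemma mult_localization: "r \<in> R \<Longrightarrow> u \<in> M \<Longrightarrow> r * u \<in> M"
  by (metis mem_localization_iff mult_in mult.left_commute)

lemma common_denominator:
  assumes "u \<in> M" "v \<in> M"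
  obtains k where "f ^ k * u \<in> R" "f ^ k * v \<in> R"
  by (metis assms f_pow_mono mem_localization_iff nle_le)

lemma diff_localization: "u \<in> M \<Longrightarrow> v \<in> M \<Longrightarrow> u - v \<in> M"
  by (metis common_denominator diff_in mem_localization_iff right_diff_distrib)

lemma add_localization: "u \<in> M \<Longrightarrow> v \<in> M \<Longrightarrow> u + v \<in> M"
  by (metis common_denominator add_in mem_localization_iff distrib_left)

lemma g_mult_localization: "u \<in> M \<Longrightarrow> g * u \<in> M"
proof -
  assume "u \<in> M"
  then obtain k where "f ^ k * u \<in> R" using mem_localization_iff by blast
  moreover have "f ^ Suc k * (g * u) = f ^ k * u"
  proof -
    have "f ^ Suc k * (g * u) = f * g * (f ^ k * u)" by (simp add: ac_simps)
    then show ?thesis using fg by simp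
  qed
  ultimately show ?thesis using mem_localization_iff by metis
qed

lemma g_pow_mult_localization: "u \<in> M \<Longrightarrow> g ^ k * u \<in> M"
  by (induction k) (auto simp: mult.assoc intro: g_mult_localization)

text \<open>Commuting with \<open>f\<close> means being linear over its powers, and some power of \<open>f\<close> moves \<open>u\<close>
  into \<open>R\<close>.\<close>

lemma zero_on_localization_if_commutes:
  assumes "\<And>x. x \<in> R \<Longrightarrow> \<phi> x = 0" and "\<And>u. u \<in> M \<Longrightarrow> bracket \<phi> f u = 0" and "u \<in> M"
  shows "\<phi> u = 0"
proof -
  have pow: "f ^ k * u \<in> M \<and> \<phi> (f ^ k * u) = f ^ k * \<phi> u" for k
  proof (induction k)
    case (Suc k)
    then show ?case
      using assms(2)[of "f ^ k * u"] mult_localization[OF f_in, of "f ^ k * u"]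
      by (simp add: bracket_def mult.assoc)
  qed (simp add: assms)
  obtain k where "f ^ k * u \<in> R" using assms(3) mem_localization_iff by blast
  then have "f ^ k * \<phi> u = f ^ k * 0" using assms(1) pow by (metis mult_zero_right)
  then show ?thesis using f_pow_cancel by blast
qed

text \<open>The bracket with \<open>f\<close> again vanishes on \<open>R\<close> and has lower order, hence vanishes
  by induction; so \<open>\<phi>\<close> commutes with \<open>f\<close>.\<close>

lemma zero_on_localization:
  assumes "order_below R M i \<phi>" and "\<And>x. x \<in> R \<Longrightarrow> \<phi> x = 0" and "u \<in> M"
  shows "\<phi> u = 0"
  using assms
proof (induction i arbitrary: \<phi> u)
  case (Suc i)
  have "bracket \<phi> f v = 0" if "v \<in> M" for v
  proof (rule Suc.IH[OF _ _ that])
    show "order_below R M i (bracket \<phi> f)" using Suc.prems(1) f_in by simp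
    show "bracket \<phi> f x = 0" if "x \<in> R" for x
      using that Suc.prems(2) mult_in f_in by (simp add: bracket_def)
  qed
  then show ?case using zero_on_localization_if_commutes Suc.prems by blast
qed simp

lemma extension_unique:
  assumes "order_below R M i \<phi>" "order_below R M j \<psi>"
    and "\<And>x. x \<in> R \<Longrightarrow> \<phi> x = \<psi> x" and "u \<in> M"
  shows "\<phi> u = \<psi> u"
proof -
  have "order_below R M (max i j) (\<lambda>x. \<phi> x - \<psi> x)"
    using assms(1,2) mult_localization
    by (intro order_below_diff; elim order_below_mono[rotated 2]) auto
  then show ?thesis using zero_on_localization[of "max i j" "\<lambda>x. \<phi> x - \<psi> x" u] assms(3,4) by simp
qed

text \<open>
  One step of the extension.  If the bracket \<open>\<gamma>\<close> of the desired \<open>\<phi>\<close> with \<open>f\<close> is already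
  known on \<open>M\<close>, then \<open>\<phi> u = g * \<phi> (f * u) - g * \<gamma> u\<close> is forced; iterating \<open>k\<close> times, until
  \<open>f ^ k * u\<close> lies in \<open>R\<close>, gives a closed formula for \<open>\<phi> u\<close>.
\<close>

lemma extend_with_bracket:
  assumes P: "additive_endo R P"
    and \<gamma>: "additive_endo M \<gamma>" "\<And>x. x \<in> R \<Longrightarrow> \<gamma> x = bracket P f x"
  obtains \<phi> where "additive_endo M \<phi>" "\<And>x. x \<in> R \<Longrightarrow> \<phi> x = P x"
    "\<And>u. u \<in> M \<Longrightarrow> bracket \<phi> f u = \<gamma> u"
proof -
  define \<Phi> where "\<Phi> k u = g ^ k * P (f ^ k * u) - (\<Sum>j<k. g ^ Suc j * \<gamma> (f ^ j * u))" for k u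
  have cancel: "g ^ Suc k * (f * x) = g ^ k * x" for k x
  proof -
    have "g ^ Suc k * (f * x) = f * g * (g ^ k * x)" by (simp add: ac_simps)
    then show ?thesis using fg by simp
  qed
  have step: "\<Phi> (Suc k) u = \<Phi> k u" if "f ^ k * u \<in> R" for k u
  proof -
    have "P (f ^ Suc k * u) = f * P (f ^ k * u) + \<gamma> (f ^ k * u)"
      using \<gamma>(2)[OF that] by (simp add: bracket_def mult.assoc)
    then have "g ^ Suc k * P (f ^ Suc k * u) = g ^ k * P (f ^ k * u) + g ^ Suc k * \<gamma> (f ^ k * u)"
      by (simp only: distrib_left cancel)
    then show ?thesis by (simp only: \<Phi>_def sum.lessThan_Suc) simp
  qed
  \<comment> \<open>The formula does not depend on the denominator: one more step adds a multiple of
    \<open>bracket P f x - \<gamma> x\<close> with \<open>x = f ^ k * u\<close> in \<open>R\<close>.\<close>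
  have stable: "\<Phi> l u = \<Phi> k u" if "f ^ k * u \<in> R" "k \<le> l" for k l u
    using that(2) by (induction l rule: dec_induct) (use step f_pow_mono that(1) in auto)
  define \<phi> where "\<phi> u = \<Phi> (SOME k. f ^ k * u \<in> R) u" for u
  have \<phi>: "\<phi> u = \<Phi> k u" if "f ^ k * u \<in> R" for k u
  proof -
    have "f ^ (SOME k. f ^ k * u \<in> R) * u \<in> R" using someI_ex[of "\<lambda>k. f ^ k * u \<in> R"] that by blast
    then show ?thesis unfolding \<phi>_def using stable that by (metis nle_le)
  qed
  show thesis
  proof
    show "\<phi> x = P x" if "x \<in> R" for x
      using \<phi>[of 0 x] that by (simp add: \<Phi>_def)
    have fM: "f ^ k * u \<in> M" if "u \<in> M" for u k
      using that f_pow_in mult_localization by blast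
    have sum_in: "(\<Sum>j<k. h j) \<in> M" if "\<And>j. h j \<in> M" for h :: "nat \<Rightarrow> 'a" and k
      by (induction k) (use that add_localization zero_in R_sub_localization in auto)
    show "additive_endo M \<phi>"
      unfolding additive_endo_def
    proof safe
      fix u assume u: "u \<in> M"
      then obtain k where k: "f ^ k * u \<in> R" using mem_localization_iff by blast
      then have "P (f ^ k * u) \<in> M"
        using P R_sub_localization by (auto simp: additive_endo_def)
      moreover have "\<gamma> (f ^ j * u) \<in> M" for j
        using \<gamma>(1) fM[OF u] by (auto simp: additive_endo_def)
      ultimately show "\<phi> u \<in> M"
        unfolding \<phi>[OF k] \<Phi>_def
        by (intro diff_localization sum_in g_pow_mult_localization)
    next
      fix u v assume uv: "u \<in> M" "v \<in> M"
      then obtain k where k: "f ^ k * u \<in> R" "f ^ k * v \<in> R" by (rule common_denominator)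
      then have k': "f ^ k * (u + v) \<in> R" by (simp add: distrib_left add_in)
      have "\<gamma> (f ^ j * (u + v)) = \<gamma> (f ^ j * u) + \<gamma> (f ^ j * v)" for j
        using \<gamma>(1) fM uv by (simp add: additive_endo_def distrib_left)
      moreover have "P (f ^ k * (u + v)) = P (f ^ k * u) + P (f ^ k * v)"
        using P k by (simp add: additive_endo_def distrib_left)
      ultimately show "\<phi> (u + v) = \<phi> u + \<phi> v"
        unfolding \<phi>[OF k(1)] \<phi>[OF k(2)] \<phi>[OF k'] \<Phi>_def
        by (simp only: distrib_left sum.distrib) simp
    qed
    show "bracket \<phi> f u = \<gamma> u" if u: "u \<in> M" for u
    proof -
      obtain k where k: "f ^ k * u \<in> R" using u mem_localization_iff by blast
      have k1: "f ^ Suc k * u \<in> R"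
        using f_pow_mono[OF k, of "Suc k"] by simp
      moreover have "f ^ Suc k * u = f ^ k * (f * u)" by (simp add: ac_simps)
      ultimately have k2: "f ^ k * (f * u) \<in> R" by metis
      have cancel': "f * (g ^ Suc j * x) = g ^ j * x" for j x
      proof -
        have "f * (g ^ Suc j * x) = f * g * (g ^ j * x)" by (simp add: ac_simps)
        then show ?thesis using fg by simp
      qed
      have "f * \<Phi> (Suc k) u = g ^ k * P (f ^ k * (f * u)) - (\<Sum>j<Suc k. g ^ j * \<gamma> (f ^ j * u))"
        unfolding \<Phi>_def right_diff_distrib sum_distrib_left cancel'
        by (simp only: power_Suc2 mult.assoc)
      also have "(\<Sum>j<Suc k. g ^ j * \<gamma> (f ^ j * u)) =
          \<gamma> u + (\<Sum>j<k. g ^ Suc j * \<gamma> (f ^ j * (f * u)))"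
        by (subst sum.lessThan_Suc_shift) (simp only: power_Suc2 mult.assoc power_0 mult_1)
      finally have "f * \<Phi> (Suc k) u = \<Phi> k (f * u) - \<gamma> u"
        unfolding \<Phi>_def[of k "f * u"] by (simp only: diff_diff_eq add.commute)
      then show ?thesis unfolding bracket_def \<phi>[OF k1] \<phi>[OF k2] by simp
    qed
  qed
qed

text \<open>
  The inductive hypothesis extends the bracket of \<open>P\<close> with \<open>f\<close>, from which
  \<open>extend_with_bracket\<close> builds \<open>\<phi>\<close>.  For the order of \<open>\<phi>\<close> one needs every bracket with \<open>r \<in> R\<close>: by
  the Jacobi identity its difference from the extension of the bracket of \<open>P\<close> commutes with \<open>f\<close>,
  and it vanishes on \<open>R\<close>.
\<close>

lemma extension_exists:
  assumes "additive_endo R P" and "order_below R R i P"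
  shows "\<exists>\<phi>. additive_endo M \<phi> \<and> order_below R M i \<phi> \<and> (\<forall>x\<in>R. \<phi> x = P x)"
  using assms
proof (induction i arbitrary: P)
  case 0
  then show ?case
    using zero_in R_sub_localization
    by (intro exI[of _ "\<lambda>_. 0"]) (auto simp: additive_endo_def)
next
  case (Suc i)
  have br: "\<exists>\<delta>. additive_endo M \<delta> \<and> order_below R M i \<delta> \<and> (\<forall>x\<in>R. \<delta> x = bracket P r x)"
    if "r \<in> R" for r
    using Suc that mult_in diff_in by (auto intro!: Suc.IH additive_endo_bracket)
  then obtain \<gamma> where \<gamma>: "additive_endo M \<gamma>" "order_below R M i \<gamma>" "\<And>x. x \<in> R \<Longrightarrow> \<gamma> x = bracket P f x"
    using f_in by blast
  obtain \<phi> where \<phi>: "additive_endo M \<phi>" "\<And>x. x \<in> R \<Longrightarrow> \<phi> x = P x"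
    "\<And>u. u \<in> M \<Longrightarrow> bracket \<phi> f u = \<gamma> u"
    using extend_with_bracket[OF Suc.prems(1) \<gamma>(1,3)] by blast
  have "order_below R M i (bracket \<phi> r)" if r: "r \<in> R" for r
  proof -
    obtain \<delta> where \<delta>: "additive_endo M \<delta>" "order_below R M i \<delta>" "\<And>x. x \<in> R \<Longrightarrow> \<delta> x = bracket P r x"
      using br[OF r] by blast
    \<comment> \<open>No bound on the order of \<open>\<epsilon>\<close> is available yet, but its bracket with \<open>f\<close> is expressed by
      brackets of \<open>\<gamma>\<close> and \<open>\<delta>\<close>, so that \<open>zero_on_localization\<close> applies to this bracket.\<close>
    define \<epsilon> where "\<epsilon> = (\<lambda>u. bracket \<phi> r u - \<delta> u)"
    have \<epsilon>R: "\<epsilon> x = 0" if "x \<in> R" for x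
      using \<delta>(3)[OF that] \<phi>(2) that r mult_in by (simp add: \<epsilon>_def bracket_def)
    have "order_below R M i (bracket \<epsilon> f)"
    proof -
      have "order_below R M i (bracket \<gamma> r)" "order_below R M i (bracket \<delta> f)"
        using order_below_Suc[of R M i \<gamma>] order_below_Suc[of R M i \<delta>] \<gamma>(2) \<delta>(2) r f_in mult_localization
        by auto
      then have "order_below R M i (\<lambda>u. bracket \<gamma> r u - bracket \<delta> f u)" by (rule order_below_diff)
      moreover have "bracket \<epsilon> f u = bracket \<gamma> r u - bracket \<delta> f u" if "u \<in> M" for u
        using \<phi>(3)[OF that] \<phi>(3)[OF mult_localization[OF r that]]
        by (simp add: \<epsilon>_def bracket_def algebra_simps)
      ultimately show ?thesis
        using order_below_cong[of R M "bracket \<epsilon> f" "\<lambda>u. bracket \<gamma> r u - bracket \<delta> f u"] mult_localization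
        by blast
    qed
    moreover have "bracket \<epsilon> f x = 0" if "x \<in> R" for x
      using \<epsilon>R that f_in mult_in by (simp add: bracket_def)
    ultimately have "bracket \<epsilon> f u = 0" if "u \<in> M" for u
      using zero_on_localization that by blast
    then have "bracket \<phi> r u = \<delta> u" if "u \<in> M" for u
      using zero_on_localization_if_commutes[of \<epsilon> u] \<epsilon>R that by (simp add: \<epsilon>_def)
    then show ?thesis
      using order_below_cong[of R M "bracket \<phi> r" \<delta> i] mult_localization \<delta>(2) by blast
  qed
  then show ?case using \<phi>(1,2) by auto
qed

text \<open>Order \<open>0\<close> is the only case with content: a map commuting with \<open>R\<close> is multiplication by its value
  at \<open>1\<close>.\<close>

lemma diff_ops_ord_iff:
  "\<phi> \<in> diff_ops_ord K R i \<longleftrightarrow> \<phi> \<in> Hom_on K R \<and> order_below R R (Suc i) \<phi>"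
proof (induction i arbitrary: \<phi>)
  case 0
  show ?case
  proof
    assume "\<phi> \<in> diff_ops_ord K R 0"
    then obtain r where r: "r \<in> R" "\<phi> = mult_op R r" by auto
    have "c * x \<in> R" if "c \<in> K" "x \<in> R" for c x using that K_sub mult_in by blast
    then show "\<phi> \<in> Hom_on K R \<and> order_below R R (Suc 0) \<phi>"
      using r mult_in add_in
      by (auto simp: mult_op_def Hom_on_def bracket_def algebra_simps)
  next
    assume \<phi>: "\<phi> \<in> Hom_on K R \<and> order_below R R (Suc 0) \<phi>"
    have "\<phi> = mult_op R (\<phi> 1)"
    proof
      fix x
      show "\<phi> x = mult_op R (\<phi> 1) x"
      proof (cases "x \<in> R")
        case True
        then have "\<phi> (x * 1) - x * \<phi> 1 = 0"
          using \<phi> one_in by (simp only: order_below.simps bracket_def)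
        then show ?thesis using True by (simp add: mult_op_def mult.commute)
      next
        case False
        then show ?thesis using \<phi> by (auto simp: Hom_on_def mult_op_def PiE_def extensional_def)
      qed
    qed
    moreover have "\<phi> 1 \<in> R" using \<phi> one_in by (auto simp: Hom_on_def)
    ultimately show "\<phi> \<in> diff_ops_ord K R 0" by auto
  qed
next
  case (Suc i)
  have "commutator_op R \<phi> r \<in> Hom_on K R" if \<phi>: "\<phi> \<in> Hom_on K R" and r: "r \<in> R" for r
  proof -
    have lin: "\<phi> x \<in> R" "\<phi> (x + y) = \<phi> x + \<phi> y" "c \<in> K \<Longrightarrow> \<phi> (c * x) = c * \<phi> x"
      if "x \<in> R" "y \<in> R" for x y c
      using \<phi> that by (auto simp: Hom_on_def)
    have Kx: "c * x \<in> R" if "c \<in> K" "x \<in> R" for c x using that K_sub mult_in by blast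
    have "\<phi> (r * (c * x)) - r * \<phi> (c * x) = c * (\<phi> (r * x) - r * \<phi> x)"
      if "c \<in> K" "x \<in> R" for c x
    proof -
      have "\<phi> (r * (c * x)) = c * \<phi> (r * x)"
        using lin(3)[of "r * x" x c] that r mult_in by (simp only: mult.left_commute[of r c])
      then show ?thesis
        using lin(3)[of x x c] that by (simp only: mult.left_commute[of r c] right_diff_distrib)
    qed
    then show ?thesis
      using r mult_in add_in diff_in lin(1,2) Kx
      unfolding Hom_on_def commutator_op_def
      by (simp add: distrib_left)
  qed
  moreover have "order_below R R (Suc i) (commutator_op R \<phi> r) \<longleftrightarrow> order_below R R (Suc i) (bracket \<phi> r)"
    if "r \<in> R" for r
    by (rule order_below_cong) (use mult_in in \<open>auto simp: commutator_op_def bracket_def\<close>)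
  ultimately show ?case
    using Suc.IH by (auto simp del: order_below.simps(2) simp: order_below.simps(2)[of _ _ "Suc i"])
qed

lemma diff_ops_iff:
  "\<phi> \<in> diff_ops K R \<longleftrightarrow> \<phi> \<in> Hom_on K R \<and> (\<exists>i. order_below R R i \<phi>)"
  unfolding diff_ops_def using diff_ops_ord_iff order_below_Suc[of R R] mult_in by blast

lemma Hom_onD:
  assumes "\<phi> \<in> Hom_on K R"
  shows "x \<in> R \<Longrightarrow> \<phi> x \<in> R"
    and "x \<in> R \<Longrightarrow> y \<in> R \<Longrightarrow> \<phi> (x + y) = \<phi> x + \<phi> y"
    and "c \<in> K \<Longrightarrow> x \<in> R \<Longrightarrow> \<phi> (c * x) = c * \<phi> x"
    and "x \<notin> R \<Longrightarrow> \<phi> x = undefined"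
  using assms by (auto simp: Hom_on_def PiE_def extensional_def)

lemma Hom_onI:
  assumes "\<And>x. x \<in> R \<Longrightarrow> \<phi> x \<in> R"
    and "\<And>x y. x \<in> R \<Longrightarrow> y \<in> R \<Longrightarrow> \<phi> (x + y) = \<phi> x + \<phi> y"
    and "\<And>c x. c \<in> K \<Longrightarrow> x \<in> R \<Longrightarrow> \<phi> (c * x) = c * \<phi> x"
    and "\<And>x. x \<notin> R \<Longrightarrow> \<phi> x = undefined"
  shows "\<phi> \<in> Hom_on K R"
  using assms by (auto simp: Hom_on_def PiE_def extensional_def)

lemma Hom_on_additive_endo: "\<phi> \<in> Hom_on K R \<Longrightarrow> additive_endo R \<phi>"
  by (auto simp: Hom_on_def additive_endo_def)

lemma mult_op_diff_ops: "r \<in> R \<Longrightarrow> mult_op R r \<in> diff_ops K R"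
  unfolding diff_ops_def by (auto intro: exI[of _ 0])

lemma diff_ops_add:
  assumes "P \<in> diff_ops K R" and "Q \<in> diff_ops K R"
  shows "(\<lambda>x\<in>R. P x + Q x) \<in> diff_ops K R"
proof -
  obtain i j where PQ: "P \<in> Hom_on K R" "order_below R R i P" "Q \<in> Hom_on K R" "order_below R R j Q"
    using assms diff_ops_iff by blast
  have "order_below R R (max i j) (\<lambda>x. P x + Q x)"
    using PQ mult_in by (intro order_below_add; elim order_below_mono[rotated 2]) auto
  then have "order_below R R (max i j) (\<lambda>x\<in>R. P x + Q x)"
    using order_below_cong[of R R "\<lambda>x. P x + Q x" "\<lambda>x\<in>R. P x + Q x"] mult_in by simp
  moreover have "c * x \<in> R" if "c \<in> K" "x \<in> R" for c x using that K_sub mult_in by blast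
  then have "(\<lambda>x\<in>R. P x + Q x) \<in> Hom_on K R"
    using Hom_onD[OF PQ(1)] Hom_onD[OF PQ(3)] add_in by (intro Hom_onI) (auto simp: distrib_left)
  ultimately show ?thesis using diff_ops_iff by blast
qed

lemma diff_ops_compose:
  assumes "P \<in> diff_ops K R" and "Q \<in> diff_ops K R"
  shows "compose R P Q \<in> diff_ops K R"
proof -
  obtain i j where PQ: "P \<in> Hom_on K R" "order_below R R i P" "Q \<in> Hom_on K R" "order_below R R j Q"
    using assms diff_ops_iff by blast
  have "order_below R R (i + j) (\<lambda>x. P (Q x))"
    using PQ mult_in diff_in by (intro order_below_compose Hom_on_additive_endo)
  then have "order_below R R (i + j) (compose R P Q)"
    using order_below_cong[of R R "\<lambda>x. P (Q x)" "compose R P Q"] mult_in by (simp add: compose_def)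
  moreover have "c * x \<in> R" if "c \<in> K" "x \<in> R" for c x using that K_sub mult_in by blast
  then have "compose R P Q \<in> Hom_on K R"
    using Hom_onD[OF PQ(1)] Hom_onD[OF PQ(3)] add_in by (intro Hom_onI) (auto simp: compose_def)
  ultimately show ?thesis using diff_ops_iff by blast
qed

text \<open>The condition in the definite description that defines \<open>loc_action\<close>.\<close>

definition is_loc_action :: "(('a \<Rightarrow> 'a) \<Rightarrow> 'a \<Rightarrow> 'a) \<Rightarrow> bool" where
  "is_loc_action act \<longleftrightarrow> left_D_module K R M act \<and>
     (\<forall>r\<in>R. \<forall>u\<in>M. act (mult_op R r) u = r * u) \<and>
     (\<forall>P\<in>diff_ops K R. \<forall>x\<in>R. act P x = P x)"

text \<open>The module laws turn commutators in the ring of operators into commutators of the actions: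
  \<open>[P, r] = P r + (-r) P\<close> uses only sums and compositions.\<close>

lemma loc_action_bracket:
  assumes act: "is_loc_action act" and P: "P \<in> diff_ops K R" and r: "r \<in> R" and u: "u \<in> M"
  shows "act (commutator_op R P r) u = bracket (act P) r u"
    and "commutator_op R P r \<in> diff_ops K R"
proof -
  let ?m = "mult_op R r" and ?m' = "mult_op R (- r)" and ?C = "commutator_op R P r"
  have module: "act P (u + v) = act P u + act P v"
      "act (\<lambda>x\<in>R. P x + Q x) u = act P u + act Q u"
      "act (compose R P Q) u = act P (act Q u)"
    if "P \<in> diff_ops K R" "Q \<in> diff_ops K R" "u \<in> M" "v \<in> M" for P Q u v
    using act that unfolding is_loc_action_def left_D_module_def by blast+
  have mult: "act (mult_op R s) u = s * u" if "s \<in> R" "u \<in> M" for s u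
    using act that unfolding is_loc_action_def by blast
  have aM: "act P u \<in> M"
    using act P u unfolding is_loc_action_def left_D_module_def by blast
  have r': "- r \<in> R" using diff_in[OF zero_in r] by simp
  have PR: "P x \<in> R" if "x \<in> R" for x using P that by (auto simp: diff_ops_iff Hom_on_def)
  have D: "?m \<in> diff_ops K R" "?m' \<in> diff_ops K R" using r r' mult_op_diff_ops by auto
  have D': "compose R P ?m \<in> diff_ops K R" "compose R ?m' P \<in> diff_ops K R"
    using D P diff_ops_compose by auto
  have C: "?C = (\<lambda>x\<in>R. compose R P ?m x + compose R ?m' P x)"
    using PR by (auto simp: commutator_op_def compose_def mult_op_def fun_eq_iff)
  then show "?C \<in> diff_ops K R" using diff_ops_add[OF D'] by simp
  have "act ?C u = act (compose R P ?m) u + act (compose R ?m' P) u"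
    unfolding C using module(2)[OF D' u u] .
  also have "\<dots> = act P (r * u) + - r * act P u"
    using module(3) D P u mult r r' aM by simp
  finally show "act ?C u = bracket (act P) r u" by (simp add: bracket_def)
qed

text \<open>Any admissible action carries differential operators of \<open>R\<close> to differential operators on the
  localization, so that \<open>extension_unique\<close> applies to it and fixes it.\<close>

lemma loc_action_order:
  assumes act: "is_loc_action act"
    and "P \<in> diff_ops K R" and "order_below R R i P"
  shows "order_below R M i (act P)"
  using assms(2,3)
proof (induction i arbitrary: P)
  case 0
  then have "P = mult_op R 0"
    by (auto simp: mult_op_def diff_ops_iff Hom_on_def PiE_def extensional_def fun_eq_iff)
  then show ?case using act zero_in unfolding is_loc_action_def by auto
next
  case (Suc i)
  have "order_below R M i (bracket (act P) r)" if r: "r \<in> R" for r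
  proof -
    have "order_below R R i (commutator_op R P r)"
      using Suc.prems(2) r order_below_cong[of R R "commutator_op R P r" "bracket P r"] mult_in
      by (simp add: commutator_op_def bracket_def)
    then have "order_below R M i (act (commutator_op R P r))"
      using Suc.IH loc_action_bracket(2)[OF act Suc.prems(1) r] zero_in R_sub_localization by blast
    then show ?thesis
      using order_below_cong[of R M "bracket (act P) r" "act (commutator_op R P r)"]
        loc_action_bracket(1)[OF act Suc.prems(1) r] mult_localization by simp
  qed
  then show ?case by simp
qed

lemma loc_action_eq_extension:
  assumes "is_loc_action act" and "P \<in> diff_ops K R"
    and "order_below R M i \<phi>" and "\<And>x. x \<in> R \<Longrightarrow> \<phi> x = P x" and "u \<in> M"
  shows "act P u = \<phi> u"
proof -
  obtain j where "order_below R R j P" using assms(2) diff_ops_iff by blast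
  then have "order_below R M j (act P)" using loc_action_order assms(1,2) by blast
  moreover have "act P x = \<phi> x" if "x \<in> R" for x
    using assms that unfolding is_loc_action_def by simp
  ultimately show ?thesis using extension_unique assms(3,5) by blast
qed

lemma is_loc_action_exists: "\<exists>act. is_loc_action act"
proof -
  have "\<exists>\<phi>. additive_endo M \<phi> \<and> (\<exists>i. order_below R M i \<phi>) \<and> (\<forall>x\<in>R. \<phi> x = P x)"
    if "P \<in> diff_ops K R" for P
  proof -
    obtain i where "order_below R R i P" using \<open>P \<in> diff_ops K R\<close> diff_ops_iff by blast
    then show ?thesis
      using extension_exists Hom_on_additive_endo that diff_ops_iff by meson
  qed
  then obtain E where E: "\<And>P. P \<in> diff_ops K R \<Longrightarrow> additive_endo M (E P)"
    "\<And>P. P \<in> diff_ops K R \<Longrightarrow> \<exists>i. order_below R M i (E P)"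
    "\<And>P x. P \<in> diff_ops K R \<Longrightarrow> x \<in> R \<Longrightarrow> E P x = P x"
    by metis
  have E_eq: "E P u = \<phi> u"
    if "P \<in> diff_ops K R" "order_below R M i \<phi>" "\<And>x. x \<in> R \<Longrightarrow> \<phi> x = P x" "u \<in> M" for P \<phi> i u
  proof -
    obtain j where "order_below R M j (E P)" using E(2) \<open>P \<in> diff_ops K R\<close> by blast
    then show ?thesis
      by (rule extension_unique) (use that E(3) in auto)
  qed
  have EM: "E P u \<in> M" if "P \<in> diff_ops K R" "u \<in> M" for P u
    using E(1) that by (auto simp: additive_endo_def)
  define act where "act = (\<lambda>P\<in>diff_ops K R. \<lambda>u\<in>M. E P u)"
  have act: "act P u = E P u" if "P \<in> diff_ops K R" "u \<in> M" for P u
    using that by (simp add: act_def)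
  have mult: "act (mult_op R r) u = r * u" if "r \<in> R" "u \<in> M" for r u
    using E_eq[OF mult_op_diff_ops[OF that(1)] order_below_mult[of R M r] _ that(2)] act that mult_op_diff_ops
    by (simp add: mult_op_def)
  have 1: "act \<in> diff_ops K R \<rightarrow>\<^sub>E (M \<rightarrow>\<^sub>E M)"
    using EM by (auto simp: act_def)
  have 2: "act P (u + v) = act P u + act P v" if "P \<in> diff_ops K R" "u \<in> M" "v \<in> M" for P u v
    using E(1) that add_localization by (simp add: act additive_endo_def)
  have 3: "act (\<lambda>x\<in>R. P x + Q x) u = act P u + act Q u"
    if PQ: "P \<in> diff_ops K R" "Q \<in> diff_ops K R" and u: "u \<in> M" for P Q u
  proof -
    obtain i j where ij: "order_below R M i (E P)" "order_below R M j (E Q)" using E(2) PQ by blast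
    have "order_below R M (max i j) (\<lambda>x. E P x + E Q x)"
      using ij mult_localization by (intro order_below_add; elim order_below_mono[rotated 2]) auto
    from E_eq[OF diff_ops_add[OF PQ] this _ u] show ?thesis
      using act PQ diff_ops_add[OF PQ] u E(3) by simp
  qed
  have 4: "act (compose R P Q) u = act P (act Q u)"
    if PQ: "P \<in> diff_ops K R" "Q \<in> diff_ops K R" and u: "u \<in> M" for P Q u
  proof -
    obtain i j where ij: "order_below R M i (E P)" "order_below R M j (E Q)" using E(2) PQ by blast
    have "order_below R M (i + j) (\<lambda>x. E P (E Q x))"
      using ij E(1) PQ mult_localization diff_localization by (intro order_below_compose)
    moreover have "Q x \<in> R" if "x \<in> R" for x using PQ that by (auto simp: diff_ops_iff Hom_on_def)
    ultimately show ?thesis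
      using E_eq[OF diff_ops_compose[OF PQ], of "i + j" "\<lambda>x. E P (E Q x)" u]
        act PQ diff_ops_compose[OF PQ] u E(3) EM by (simp add: compose_def)
  qed
  have "(\<lambda>x\<in>R. x) = mult_op R 1" by (auto simp: mult_op_def)
  then have 5: "act (\<lambda>x\<in>R. x) u = u" if "u \<in> M" for u
    using mult[OF one_in that] by simp
  have 6: "act P x = P x" if "P \<in> diff_ops K R" "x \<in> R" for P x
    using act E(3) that R_sub_localization by auto
  have "is_loc_action act"
    unfolding is_loc_action_def left_D_module_def
    using 1 2 3 4 5 6 mult by blast
  then show ?thesis by blast
qed

lemma is_loc_action_loc_action: "is_loc_action (loc_action K R g)"
proof -
  obtain act where act: "is_loc_action act" using is_loc_action_exists by blast
  have "act' = act" if act': "is_loc_action act'" for act'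
  proof (rule PiE_ext)
    show "act \<in> diff_ops K R \<rightarrow>\<^sub>E (M \<rightarrow>\<^sub>E M)" "act' \<in> diff_ops K R \<rightarrow>\<^sub>E (M \<rightarrow>\<^sub>E M)"
      using act act' by (auto simp: is_loc_action_def left_D_module_def)
    then have *: "act P \<in> M \<rightarrow>\<^sub>E M" "act' P \<in> M \<rightarrow>\<^sub>E M" if "P \<in> diff_ops K R" for P
      using that by auto
    fix P assume P: "P \<in> diff_ops K R"
    obtain i where "order_below R R i P" using P diff_ops_iff by blast
    then have "order_below R M i (act P)" using loc_action_order act P by blast
    then have "act' P u = act P u" if "u \<in> M" for u
      using loc_action_eq_extension[OF act' P _ _ that] act P unfolding is_loc_action_def by blast
    then show "act' P = act P" using *[OF P] by (auto intro: PiE_ext)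
  qed
  then have "\<exists>!act. is_loc_action act" using act by blast
  then have "is_loc_action (THE act. is_loc_action act)" by (rule theI')
  then show ?thesis unfolding loc_action_def is_loc_action_def .
qed

lemma loc_action_eq:
  assumes "P \<in> diff_ops K R" and "order_below R M i \<phi>" and "\<And>x. x \<in> R \<Longrightarrow> \<phi> x = P x"
    and "u \<in> M"
  shows "loc_action K R g P u = \<phi> u"
  using loc_action_eq_extension is_loc_action_loc_action assms by blast

lemma loc_action_in: "P \<in> diff_ops K R \<Longrightarrow> u \<in> M \<Longrightarrow> loc_action K R g P u \<in> M"
  using is_loc_action_loc_action unfolding is_loc_action_def left_D_module_def by blast

end

section \<open>Complements of up-sets of exponents\<close>

definition box :: "'n set \<Rightarrow> ('n \<Rightarrow> nat) \<Rightarrow> ('n \<Rightarrow> nat) set" where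
  "box J c = {m. \<forall>j. j \<notin> J \<longrightarrow> m j = c j}"

text \<open>
  If the box meets \<open>U\<close> in a point \<open>v\<close>, then every point of the box outside \<open>U\<close> has some free
  coordinate \<open>j\<close> below \<open>v j\<close>.  It therefore lies in one of finitely many boxes with fewer free
  coordinates, to which induction applies.
\<close>

lemma box_minus_upset_finite_union:
  fixes U :: "('n::finite \<Rightarrow> nat) set"
  assumes up: "\<And>m m'. m \<in> U \<Longrightarrow> m \<le> m' \<Longrightarrow> m' \<in> U"
  shows "\<exists>B. finite B \<and> box J c - U = (\<Union>(J, c)\<in>B. box J c)"
proof -
  have "finite J" by simp
  then show ?thesis
  proof (induction J arbitrary: c rule: finite_psubset_induct)
    case (psubset J)
    show ?case
    proof (cases "box J c \<inter> U = {}")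
      case True
      then show ?thesis by (intro exI[of _ "{(J, c)}"]) auto
    next
      case False
      then obtain v where v: "v \<in> box J c" "v \<in> U" by blast
      define covers where "covers j l B \<longleftrightarrow>
        finite B \<and> box (J - {j}) (c(j := l)) - U = (\<Union>(J, c)\<in>B. box J c)" for j l B
      have "\<exists>B. covers j l B" if "j \<in> J" for j l
        unfolding covers_def by (rule psubset.IH) (use that in auto)
      then obtain B where B: "\<And>j l. j \<in> J \<Longrightarrow> covers j l (B j l)"
        by metis
      have "box J c - U = (\<Union>j\<in>J. \<Union>l<v j. box (J - {j}) (c(j := l)) - U)"
      proof (intro equalityI subsetI)
        fix m assume m: "m \<in> box J c - U"
        then have "\<not> v \<le> m" using up v by blast
        then obtain j where j: "m j < v j" by (auto simp: le_fun_def not_le)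
        then have "j \<in> J" using m v unfolding box_def by fastforce
        moreover have "m \<in> box (J - {j}) (c(j := m j)) - U" using m by (auto simp: box_def)
        ultimately show "m \<in> (\<Union>j\<in>J. \<Union>l<v j. box (J - {j}) (c(j := l)) - U)" using j by blast
      next
        fix m assume "m \<in> (\<Union>j\<in>J. \<Union>l<v j. box (J - {j}) (c(j := l)) - U)"
        then obtain j l where "j \<in> J" "m \<in> box (J - {j}) (c(j := l))" "m \<notin> U" by blast
        then have "m i = c i" if "i \<notin> J" for i
          using that by (cases "i = j") (auto simp: box_def)
        then show "m \<in> box J c - U" using \<open>m \<notin> U\<close> by (simp add: box_def)
      qed
      also have "\<dots> = (\<Union>j\<in>J. \<Union>l<v j. \<Union>(J, c)\<in>B j l. box J c)"
        using B unfolding covers_def by (intro SUP_cong refl) blast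
      also have "\<dots> = (\<Union>(J, c)\<in>(\<Union>j\<in>J. \<Union>l<v j. B j l). box J c)"
        by (simp only: UN_UN_flatten)
      finally have "box J c - U = (\<Union>(J, c)\<in>(\<Union>j\<in>J. \<Union>l<v j. B j l). box J c)" .
      moreover have "finite (\<Union>j\<in>J. \<Union>l<v j. B j l)"
        using B psubset.hyps(1) unfolding covers_def by blast
      ultimately show ?thesis by blast
    qed
  qed
qed

text \<open>
  Linear algebra over the rationals: either \<open>v\<close> is in the rational span of the \<open>a j\<close>, and
  clearing denominators gives the first case, or some rational functional separates it from the span.
  It is constructed over the rationals, so that the alternative is a dependence whose denominators can be
  cleared, and then mapped to the field of coefficients, because it will be the symbol of a differential operator.
\<close>

lemma rational_dependence_or_functional:
  fixes a :: "'n::finite \<Rightarrow> int ^ 'd" and v :: "int ^ 'd"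
  obtains (dependence) N z where "N > 0" "int N *s v = (\<Sum>j\<in>J. z j *s a j)"
    | (functional) h :: "int ^ 'd \<Rightarrow> 'k::field_char_0"
      where "\<And>x y. h (x + y) = h x + h y" "\<And>z x. h (z *s x) = of_int z * h x"
        "\<And>j. j \<in> J \<Longrightarrow> h (a j) = 0" "h v \<noteq> 0"
proof -
  define emb :: "int ^ 'd \<Rightarrow> rat ^ 'd" where "emb x = (\<chi> i. of_int (x $ i))" for x
  have emb_add: "emb (x + y) = emb x + emb y" and emb_scale: "emb (z *s x) = of_int z *s emb x" for x y z
    by (simp_all add: emb_def vec_eq_iff)
  have emb_inj: "emb x = emb y \<longleftrightarrow> x = y" for x y
    by (simp add: emb_def vec_eq_iff)
  show thesis
  proof (cases "emb v \<in> vec.span (emb ` a ` J)")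
    case True
    define P where "P w \<longleftrightarrow> (\<exists>N z. N > 0 \<and> of_int (int N) *s w = emb (\<Sum>j\<in>J. z j *s a j))"
      for w :: "rat ^ 'd"
    have "P (emb v)"
      using True
    proof (induction rule: vec.span_induct)
      show "vec.subspace (Collect P)"
      proof (rule vec.subspaceI)
        have "of_int (int 1) *s 0 = emb (\<Sum>j\<in>J. 0 *s a j)" by (simp add: emb_def vec_eq_iff)
        then show "0 \<in> Collect P"
          unfolding P_def mem_Collect_eq by (intro exI[of _ 1] exI[of _ "\<lambda>_. 0"]) auto
      next
        fix x y assume "x \<in> Collect P" "y \<in> Collect P"
        then obtain N z N' z' where N: "N > 0" "of_int (int N) *s x = emb (\<Sum>j\<in>J. z j *s a j)"
          "N' > 0" "of_int (int N') *s y = emb (\<Sum>j\<in>J. z' j *s a j)"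
          unfolding P_def by blast
        have "of_int (int (N * N')) *s (x + y)
            = of_int (int N') *s (of_int (int N) *s x) + of_int (int N) *s (of_int (int N') *s y)"
          by (simp add: vec_eq_iff algebra_simps)
        also have "\<dots> = emb (int N' *s (\<Sum>j\<in>J. z j *s a j) + int N *s (\<Sum>j\<in>J. z' j *s a j))"
          unfolding N(2,4) emb_add emb_scale ..
        also have "int N' *s (\<Sum>j\<in>J. z j *s a j) + int N *s (\<Sum>j\<in>J. z' j *s a j)
            = (\<Sum>j\<in>J. (int N' * z j + int N * z' j) *s a j)"
          by (simp add: vec_eq_iff sum.distrib sum_distrib_left algebra_simps)
        finally show "x + y \<in> Collect P"
          unfolding P_def mem_Collect_eq using N(1,3)
          by (intro exI[of _ "N * N'"] exI[of _ "\<lambda>j. int N' * z j + int N * z' j"]) simp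
      next
        fix c :: rat and x assume "x \<in> Collect P"
        then obtain N z where N: "N > 0" "of_int (int N) *s x = emb (\<Sum>j\<in>J. z j *s a j)"
          unfolding P_def by blast
        obtain p q where c: "c = of_int p / of_int q" "q > 0"
          using quotient_of_div[of c] quotient_of_denom_pos[of c] by (cases "quotient_of c") blast
        have "of_int (int (nat q * N)) *s (c *s x) = of_int p *s (of_int (int N) *s x)"
          using c by (simp add: vec_eq_iff)
        also have "\<dots> = emb (p *s (\<Sum>j\<in>J. z j *s a j))"
          unfolding N(2) emb_scale ..
        also have "p *s (\<Sum>j\<in>J. z j *s a j) = (\<Sum>j\<in>J. (p * z j) *s a j)"
          by (simp add: vec_eq_iff sum_distrib_left algebra_simps)
        finally show "c *s x \<in> Collect P"
          unfolding P_def mem_Collect_eq using N(1) c(2)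
          by (intro exI[of _ "nat q * N"] exI[of _ "\<lambda>j. p * z j"]) simp
      qed
    next
      fix x assume "x \<in> emb ` a ` J"
      then obtain i where i: "i \<in> J" "x = emb (a i)" by blast
      have "(\<Sum>j\<in>J. (if j = i then 1 else 0) *s a j) = (\<Sum>j\<in>J. if j = i then a j else 0)"
        by (intro sum.cong) auto
      also have "\<dots> = a i" using i by simp
      finally show "P x"
        unfolding P_def using i by (intro exI[of _ 1] exI[of _ "\<lambda>j. if j = i then 1 else 0"]) simp
    qed
    then obtain N z where "N > 0" "emb (int N *s v) = emb (\<Sum>j\<in>J. z j *s a j)"
      unfolding P_def emb_scale by blast
    then show thesis unfolding emb_inj by (rule dependence)
  next
    case False
    obtain B where B: "B \<subseteq> emb ` a ` J" "vec.independent B" "emb ` a ` J \<subseteq> vec.span B"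
      using vec.maximal_independent_subset by blast
    have "vec.span B \<subseteq> vec.span (emb ` a ` J)" using B(1) by (rule vec.span_mono)
    then have v: "emb v \<notin> vec.span B" using False by blast
    then have "vec.independent (insert (emb v) B)" using B(2) by (rule vec.independent_insertI)
    from vec.linear_independent_extend[OF this, of "\<lambda>x. if x = emb v then emb v else 0"]
    obtain L where lin: "Vector_Spaces.linear (*s) (*s) L"
      and L': "\<forall>x\<in>insert (emb v) B. L x = (if x = emb v then emb v else 0)"
      by (elim exE conjE)
    have L: "L x = (if x = emb v then emb v else 0)" if "x \<in> insert (emb v) B" for x
      using L' that by (rule bspec)
    have "emb v \<notin> B" using v vec.span_base by blast
    then have "L x = 0" if "x \<in> B" for x using L[of x] that by auto
    then have zero: "L (emb (a j)) = 0" if "j \<in> J" for j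
      using vec.linear_eq_0_on_span[OF lin, of B] B(3) that by blast
    have "emb v \<noteq> 0" using v vec.span_zero by metis
    then obtain i where i: "emb v $ i \<noteq> 0" by (auto simp: vec_eq_iff)
    show thesis
    proof (rule functional[of "\<lambda>x. of_rat (L (emb x) $ i)"])
      show "of_rat (L (emb (x + y)) $ i) = of_rat (L (emb x) $ i) + (of_rat (L (emb y) $ i) :: 'k)" for x y
        using vec.linear_add[OF lin] by (simp add: emb_add of_rat_add)
      show "of_rat (L (emb (z *s x)) $ i) = of_int z * (of_rat (L (emb x) $ i) :: 'k)" for z x
        using vec.linear_scale[OF lin] by (simp add: emb_scale of_rat_mult)
      show "of_rat (L (emb (a j)) $ i) = (0 :: 'k)" if "j \<in> J" for j
        using zero[OF that] by simp
      show "of_rat (L (emb v) $ i) \<noteq> (0 :: 'k)"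
        using L[of "emb v"] i by simp
    qed
  qed
qed

section \<open>Diagonal differential operators on Laurent polynomials\<close>

text \<open>For a polynomial function \<open>p\<close> this is \<open>p(\<theta>)\<close>, with \<open>\<theta>\<^sub>i = t\<^sub>i \<partial>\<^sub>i\<close> the Euler operators.\<close>

definition diag :: "(int ^ 'd \<Rightarrow> 'k) \<Rightarrow> ('k::comm_ring_1, 'd) laurent \<Rightarrow> ('k, 'd) laurent" where
  "diag p x = Abs_poly_mapping (\<lambda>a. p a * Poly_Mapping.lookup x a)"

lemma lookup_diag: "Poly_Mapping.lookup (diag p x) a = p a * Poly_Mapping.lookup x a"
proof -
  have "{a. p a * Poly_Mapping.lookup x a \<noteq> 0} \<subseteq> Poly_Mapping.keys x"
    by (auto simp: in_keys_iff)
  then have "finite {a. p a * Poly_Mapping.lookup x a \<noteq> 0}"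
    by (rule finite_subset) simp
  then show ?thesis by (simp add: diag_def)
qed

lemma diag_add: "diag p (x + y) = diag p x + diag p y"
  by (rule poly_mapping_eqI) (simp add: lookup_diag lookup_add algebra_simps)

lemma diag_single: "diag p (Poly_Mapping.single a s) = Poly_Mapping.single a (p a * s)"
  by (rule poly_mapping_eqI) (simp add: lookup_diag lookup_single when_def)

lemma diag_diag: "diag p (diag q x) = diag (\<lambda>a. p a * q a) x"
  by (rule poly_mapping_eqI) (simp add: lookup_diag mult.assoc)

lemma additive_laurent_ext:
  fixes \<phi> \<psi> :: "('k::comm_ring_1, 'd) laurent \<Rightarrow> ('k, 'd) laurent"
  assumes "\<And>x y. \<phi> (x + y) = \<phi> x + \<phi> y" "\<And>x y. \<psi> (x + y) = \<psi> x + \<psi> y"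
    and "\<And>a s. \<phi> (Poly_Mapping.single a s) = \<psi> (Poly_Mapping.single a s)"
  shows "\<phi> x = \<psi> x"
proof -
  have "\<phi> 0 = 0" "\<psi> 0 = 0" using assms(1,2)[of 0 0] by simp_all
  have *: "\<phi> (\<Sum>a\<in>F. Poly_Mapping.single a (c a)) = \<psi> (\<Sum>a\<in>F. Poly_Mapping.single a (c a))" for F c
    by (induction F rule: infinite_finite_induct) (simp_all add: assms \<open>\<phi> 0 = 0\<close> \<open>\<psi> 0 = 0\<close>)
  have "x = (\<Sum>a\<in>Poly_Mapping.keys x. Poly_Mapping.single a (Poly_Mapping.lookup x a))"
    by (rule poly_mapping_eqI)
      (simp add: lookup_sum lookup_single when_def in_keys_iff cong: if_cong)
  then show ?thesis using * by metis
qed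

lemma diag_const: "diag (\<lambda>_. s) x = Poly_Mapping.single 0 s * x"
  by (rule additive_laurent_ext[where x = x])
    (simp_all add: diag_add diag_single distrib_left mult_single)

lemma diag_derivation:
  assumes "\<And>a b. h (a + b) = h a + h b"
  shows "diag h (x * y) = diag h x * y + x * diag h y"
proof (rule additive_laurent_ext[where x = x])
  fix a s
  show "diag h (Poly_Mapping.single a s * y) =
      diag h (Poly_Mapping.single a s) * y + Poly_Mapping.single a s * diag h y"
    by (rule additive_laurent_ext[where x = y])
      (simp_all add: diag_add diag_single distrib_left mult_single assms single_add[symmetric] algebra_simps)
qed (simp_all add: diag_add algebra_simps)

text \<open>These \<open>p\<close> stand in for polynomial functions: the closure properties below are all that is
  needed of the latter.\<close>

definition diff_symbol :: "(int ^ 'd \<Rightarrow> 'k::comm_ring_1) \<Rightarrow> bool" where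
  "diff_symbol p \<longleftrightarrow> (\<exists>i. order_below UNIV UNIV i (diag p))"

lemma diff_symbol_const: "diff_symbol (\<lambda>_. s)"
  unfolding diff_symbol_def diag_const[abs_def] using order_below_mult by blast

lemma diff_symbol_additive:
  assumes "\<And>a b. h (a + b) = h a + h b"
  shows "diff_symbol h"
proof -
  have "bracket (diag h) r = (\<lambda>x. diag h r * x)" for r
    using diag_derivation[OF assms] by (simp add: bracket_def fun_eq_iff)
  then have "order_below UNIV UNIV (Suc (Suc 0)) (diag h)"
    using order_below_mult by (metis order_below.simps(2))
  then show ?thesis unfolding diff_symbol_def by blast
qed

lemma diff_symbol_diff:
  assumes "diff_symbol p" "diff_symbol q"
  shows "diff_symbol (\<lambda>a. p a - q a)"
proof -
  obtain i j where "order_below UNIV UNIV i (diag p)" "order_below UNIV UNIV j (diag q)"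
    using assms unfolding diff_symbol_def by blast
  then have "order_below UNIV UNIV (max i j) (\<lambda>x. diag p x - diag q x)"
    by (intro order_below_diff; elim order_below_mono[rotated 2]) auto
  moreover have "diag p x - diag q x = diag (\<lambda>a. p a - q a) x" for x
    by (rule poly_mapping_eqI) (simp add: lookup_diag lookup_minus algebra_simps)
  ultimately show ?thesis unfolding diff_symbol_def by auto
qed

lemma additive_endo_UNIV: "additive_endo UNIV \<phi> \<longleftrightarrow> (\<forall>x y. \<phi> (x + y) = \<phi> x + \<phi> y)"
  by (simp add: additive_endo_def)

lemma diff_symbol_mult:
  assumes "diff_symbol p" "diff_symbol q"
  shows "diff_symbol (\<lambda>a. p a * q a)"
proof -
  obtain i j where "order_below UNIV UNIV i (diag p)" "order_below UNIV UNIV j (diag q)"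
    using assms unfolding diff_symbol_def by blast
  then have "order_below UNIV UNIV (i + j) (\<lambda>x. diag p (diag q x))"
    by (intro order_below_compose) (auto simp: additive_endo_UNIV diag_add)
  then show ?thesis unfolding diff_symbol_def diag_diag by auto
qed

lemma diff_symbol_prod:
  assumes "\<And>i. i \<in> I \<Longrightarrow> diff_symbol (p i)"
  shows "diff_symbol (\<lambda>a. \<Prod>i\<in>I. p i a)"
  using assms by (induction I rule: infinite_finite_induct) (auto intro: diff_symbol_const diff_symbol_mult)

section \<open>Separating polynomials\<close>

definition lin_comb :: "int ^ 'n ^ 'd \<Rightarrow> ('n \<Rightarrow> nat) \<Rightarrow> int ^ 'd" where
  "lin_comb A m = (\<Sum>j\<in>UNIV. int (m j) *s column j A)"

lemma NA_iff: "x \<in> NA A \<longleftrightarrow> (\<exists>m. x = lin_comb A m)"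
  by (auto simp: NA_def lin_comb_def)

lemma lin_comb_add: "lin_comb A (\<lambda>j. m j + m' j) = lin_comb A m + lin_comb A m'"
  by (simp add: lin_comb_def vector_sadd_rdistrib sum.distrib)

lemma NA_lin_comb: "lin_comb A m \<in> NA A"
  by (auto simp: NA_iff)

lemma NA_zero: "0 \<in> NA A"
proof -
  have "lin_comb A (\<lambda>_. 0) = 0" by (simp add: lin_comb_def)
  then show ?thesis using NA_lin_comb[of A "\<lambda>_. 0"] by simp
qed

lemma NA_add:
  assumes "x \<in> NA A" and "y \<in> NA A"
  shows "x + y \<in> NA A"
proof -
  obtain m m' where "x = lin_comb A m" "y = lin_comb A m'" using assms by (auto simp: NA_iff)
  then show ?thesis using NA_lin_comb[of A "\<lambda>j. m j + m' j"] by (simp add: lin_comb_add)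
qed

lemma NA_scale: "x \<in> NA A \<Longrightarrow> int n *s x \<in> NA A"
  by (induction n) (auto simp: NA_zero vector_sadd_rdistrib intro: NA_add)

text \<open>
  The form is \<open>h - h(c\<^sub>0)\<close>, where \<open>h\<close> kills the columns in \<open>J\<close> and separates \<open>-b\<close> from the base point
  \<open>c\<^sub>0\<close> of the box.  If no such \<open>h\<close> exists, then \<open>N (b + c\<^sub>0)\<close> is an integral combination of these columns for some
  \<open>N > 0\<close>, and its \<open>k\<close>-fold multiple can be reached from \<open>c\<^sub>0\<close> inside the box up to a nonnegative
  combination \<open>w\<close>; that point stays in \<open>NA\<close> after subtracting \<open>k b\<close>, because \<open>k N \<ge> k\<close>.
\<close>

lemma box_avoiding_affine_form:
  fixes A :: "int ^ 'n ^ 'd"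
  assumes b: "b \<in> NA A"
    and avoid: "\<And>m. m \<in> box J c \<Longrightarrow> lin_comb A m - int k *s b \<notin> NA A"
  obtains p :: "int ^ 'd \<Rightarrow> 'k::field_char_0"
  where "diff_symbol p" "\<And>m. m \<in> box J c \<Longrightarrow> p (lin_comb A m) = 0" "p (- b) \<noteq> 0"
proof -
  define c0 where "c0 = lin_comb A (\<lambda>j. if j \<in> J then 0 else c j)"
  have split: "lin_comb A m = c0 + (\<Sum>j\<in>J. int (m j) *s column j A)" if "m \<in> box J c" for m
  proof -
    have "m = (\<lambda>j. (if j \<in> J then 0 else c j) + (if j \<in> J then m j else 0))"
      using that by (auto simp: box_def)
    then have "lin_comb A m = lin_comb A (\<lambda>j. (if j \<in> J then 0 else c j) + (if j \<in> J then m j else 0))"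
      by (rule arg_cong)
    also have "\<dots> = c0 + lin_comb A (\<lambda>j. if j \<in> J then m j else 0)"
      unfolding lin_comb_add c0_def ..
    also have "lin_comb A (\<lambda>j. if j \<in> J then m j else 0) = (\<Sum>j\<in>J. int (m j) *s column j A)"
      unfolding lin_comb_def by (rule sum.mono_neutral_cong_right) auto
    finally show ?thesis .
  qed
  show thesis
  proof (cases rule: rational_dependence_or_functional[where v = "- b - c0" and J = J
        and a = "\<lambda>j. column j A" and 'k = 'k])
    case (dependence N z)
    \<comment> \<open>The least nonnegative correction that makes all exponents \<open>w j - k z j\<close> nonnegative.\<close>
    define w where "w j = max 0 (int k * z j)" for j
    define m where "m j = (if j \<in> J then nat (w j - int k * z j) else c j)" for j
    have "m \<in> box J c" by (simp add: box_def m_def)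
    have "(\<Sum>j\<in>J. int (m j) *s column j A) = (\<Sum>j\<in>J. w j *s column j A - int k *s (z j *s column j A))"
      by (intro sum.cong)
        (auto simp: m_def w_def vector_sub_rdistrib vector_smult_assoc)
    also have "\<dots> = (\<Sum>j\<in>J. w j *s column j A) - int k *s (\<Sum>j\<in>J. z j *s column j A)"
      by (simp add: sum_subtractf vec.scale_sum_right vec_eq_iff sum_distrib_left)
    also have "\<dots> = (\<Sum>j\<in>J. w j *s column j A) + int (k * N) *s (b + c0)"
      unfolding dependence(2)[symmetric] by (simp add: vec_eq_iff algebra_simps)
    finally have "lin_comb A m - int k *s b
        = c0 + (\<Sum>j\<in>J. w j *s column j A) + int (k * N) *s c0 + int (k * N - k) *s b"
      using dependence(1) split[OF \<open>m \<in> box J c\<close>]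
      by (simp add: vec_eq_iff algebra_simps of_nat_diff)
    moreover have "c0 \<in> NA A" by (simp add: c0_def NA_lin_comb)
    moreover have "(\<Sum>j\<in>J. w j *s column j A) \<in> NA A"
    proof -
      have "(\<Sum>j\<in>J. w j *s column j A) = lin_comb A (\<lambda>j. if j \<in> J then nat (w j) else 0)"
        unfolding lin_comb_def by (rule sum.mono_neutral_cong_left) (auto simp: w_def)
      then show ?thesis by (simp add: NA_lin_comb)
    qed
    ultimately have "lin_comb A m - int k *s b \<in> NA A"
      using b by (simp only: NA_add NA_scale)
    then show thesis using avoid \<open>m \<in> box J c\<close> by blast
  next
    case (functional h)
    have h0: "h 0 = 0" using functional(1)[of 0 0] by simp
    have h_sum: "h (\<Sum>j\<in>J. g j *s column j A) = 0" for g
    proof -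
      have "h (\<Sum>j\<in>F. g j *s column j A) = (\<Sum>j\<in>F. of_int (g j) * h (column j A))" for F :: "'n set"
        by (induction F rule: infinite_finite_induct) (simp_all add: h0 functional(1,2))
      then show ?thesis using functional(3) by simp
    qed
    have "h (- b - c0) = h (- b) - h c0"
      using functional(1)[of "- b - c0" c0] by simp
    moreover have "diff_symbol (\<lambda>a. h a - h c0)"
      using functional(1) by (intro diff_symbol_diff diff_symbol_const diff_symbol_additive)
    ultimately show thesis
      using that[of "\<lambda>a. h a - h c0"] functional(1,4) split h_sum by simp
  qed
qed

text \<open>Moving up in the exponents adds elements of \<open>NA\<close>, so the exponents that remain in \<open>NA\<close> after
  subtracting \<open>k b\<close> form an up-set; its complement is cut into boxes and the affine forms are multiplied.\<close>

lemma separating_symbol: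
  fixes A :: "int ^ 'n ^ 'd"
  assumes b: "b \<in> NA A"
  obtains p :: "int ^ 'd \<Rightarrow> 'k::field_char_0"
  where "diff_symbol p" "\<And>a. a \<in> NA A \<Longrightarrow> a - int k *s b \<notin> NA A \<Longrightarrow> p a = 0" "p (- b) \<noteq> 0"
proof -
  define U where "U = {m. lin_comb A m - int k *s b \<in> NA A}"
  have up: "m' \<in> U" if "m \<in> U" "m \<le> m'" for m m'
  proof -
    have "m' = (\<lambda>j. m j + (m' j - m j))" using that(2) by (auto simp: le_fun_def)
    then have "lin_comb A m' = lin_comb A (\<lambda>j. m j + (m' j - m j))" by (rule arg_cong)
    also have "\<dots> = lin_comb A m + lin_comb A (\<lambda>j. m' j - m j)" by (rule lin_comb_add)
    finally have "lin_comb A m' = lin_comb A m + lin_comb A (\<lambda>j. m' j - m j)" .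
    then have "lin_comb A m' - int k *s b = lin_comb A m - int k *s b + lin_comb A (\<lambda>j. m' j - m j)"
      by simp
    then show ?thesis using that(1) NA_add[OF _ NA_lin_comb] unfolding U_def by (simp only: mem_Collect_eq)
  qed
  obtain B where B: "finite B" "box UNIV (\<lambda>_. 0) - U = (\<Union>(J, c)\<in>B. box J c)"
    using box_minus_upset_finite_union[of U UNIV "\<lambda>_. 0"] up by blast
  have compl: "- U = (\<Union>(J, c)\<in>B. box J c)" using B(2) by (auto simp: box_def)
  have "\<exists>p :: int ^ 'd \<Rightarrow> 'k. diff_symbol p \<and> (\<forall>m\<in>box (fst x) (snd x). p (lin_comb A m) = 0) \<and> p (- b) \<noteq> 0"
    if "x \<in> B" for x
  proof -
    have "lin_comb A m - int k *s b \<notin> NA A" if "m \<in> box (fst x) (snd x)" for m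
    proof -
      have "m \<in> - U" using compl \<open>x \<in> B\<close> that by (auto simp: case_prod_beta)
      then show ?thesis by (simp add: U_def)
    qed
    from box_avoiding_affine_form[where 'k = 'k, OF b this] show ?thesis by metis
  qed
  then obtain p :: "_ \<Rightarrow> int ^ 'd \<Rightarrow> 'k" where p: "\<And>x. x \<in> B \<Longrightarrow> diff_symbol (p x)"
    "\<And>x m. x \<in> B \<Longrightarrow> m \<in> box (fst x) (snd x) \<Longrightarrow> p x (lin_comb A m) = 0"
    "\<And>x. x \<in> B \<Longrightarrow> p x (- b) \<noteq> 0"
    by metis
  show thesis
  proof (rule that[of "\<lambda>a. \<Prod>x\<in>B. p x a"])
    show "diff_symbol (\<lambda>a. \<Prod>x\<in>B. p x a)" using p(1) by (rule diff_symbol_prod)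
    show "(\<Prod>x\<in>B. p x (- b)) \<noteq> 0" using p(3) B(1) by simp
    show "(\<Prod>x\<in>B. p x a) = 0" if a: "a \<in> NA A" "a - int k *s b \<notin> NA A" for a
    proof -
      obtain m where m: "a = lin_comb A m" using a(1) by (auto simp: NA_iff)
      then have "m \<in> - U" using a(2) by (simp add: U_def)
      then obtain x where "x \<in> B" "m \<in> box (fst x) (snd x)" unfolding compl by (auto simp: case_prod_beta)
      then have "p x a = 0" using p(2) m by blast
      then show ?thesis using \<open>x \<in> B\<close> B(1) by (simp add: prod_zero_iff) blast
    qed
  qed
qed

section \<open>The localization of a toric algebra\<close>

lemma tpow_add: "tpow a * tpow b = tpow (a + b)"
  by (simp add: tpow_def mult_single)

lemma tpow_power: "tpow a ^ k = tpow (int k *s a)"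
  by (induction k) (auto simp: tpow_add vector_sadd_rdistrib, simp add: tpow_def)

lemma tpow_in_toric_algebra: "a \<in> NA A \<Longrightarrow> tpow a \<in> toric_algebra A"
  by (auto simp: toric_algebra_def tpow_def)

lemma toric_algebra_mult:
  assumes "x \<in> toric_algebra A" "y \<in> toric_algebra A"
  shows "x * y \<in> toric_algebra A"
  using assms keys_mult[of x y] NA_add unfolding toric_algebra_def by blast

lemma scalars_sub_toric_algebra: "scalars \<subseteq> toric_algebra A"
  by (auto simp: scalars_def toric_algebra_def NA_zero split: if_splits)

lemma localized_algebra_toric:
  assumes "b \<in> NA A"
  shows "localized_algebra scalars (toric_algebra A) (tpow b) (tpow (- b))"
proof
  show "1 \<in> toric_algebra A" using tpow_in_toric_algebra[OF NA_zero] by (simp add: tpow_def)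
  show "x - y \<in> toric_algebra A" if "x \<in> toric_algebra A" "y \<in> toric_algebra A" for x y
    using that keys_diff[of x y] unfolding toric_algebra_def by blast
qed (use assms tpow_inverse tpow_in_toric_algebra toric_algebra_mult in \<open>auto intro: scalars_sub_toric_algebra[THEN subsetD]\<close>)

lemma shifted_diag_preserves_toric_algebra:
  assumes "x \<in> toric_algebra A" and "\<And>a. a \<in> NA A \<Longrightarrow> a + e \<notin> NA A \<Longrightarrow> p a = 0"
  shows "tpow e * diag p x \<in> toric_algebra A"
proof -
  have "e + a \<in> NA A" if "a \<in> Poly_Mapping.keys (diag p x)" for a
  proof -
    have "p a \<noteq> 0" "a \<in> Poly_Mapping.keys x" using that by (auto simp: in_keys_iff lookup_diag)
    then show ?thesis using assms by (auto simp: toric_algebra_def add.commute)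
  qed
  moreover have "Poly_Mapping.keys (tpow e * diag p x) \<subseteq> {e + a | a. a \<in> Poly_Mapping.keys (diag p x)}"
    using keys_mult[of "tpow e" "diag p x"] by (fastforce simp: tpow_def split: if_splits)
  ultimately show ?thesis unfolding toric_algebra_def by blast
qed

text \<open>
  The operator \<open>T\<close> below lives on the whole Laurent ring and preserves \<open>S\<close>.  Its restriction \<open>P\<close> to \<open>S\<close>
  acts on the localization as \<open>T\<close> itself, by uniqueness of extensions.  The factor
  \<open>s\<close> contains \<open>t\<^sup>b\<close> to compensate for the exponent of \<open>t\<^sup>-\<^sup>b\<close> and the inverse of \<open>p(-b)\<close> to
  normalize the scalar.
\<close>

lemma fraction_in_orbit:
  fixes A :: "int ^ 'n ^ 'd" and r :: "('k::field_char_0, 'd) laurent"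
  assumes b: "b \<in> NA A" and r: "r \<in> toric_algebra A"
  shows "\<exists>P\<in>diff_ops scalars (toric_algebra A).
    loc_action scalars (toric_algebra A) (tpow (- b)) P (tpow (- b)) = r * tpow (- b) ^ k"
proof -
  define S :: "('k, 'd) laurent set" where "S = toric_algebra A"
  interpret localized_algebra scalars S "tpow b" "tpow (- b)"
    unfolding S_def using b by (rule localized_algebra_toric)
  obtain p :: "int ^ 'd \<Rightarrow> 'k" where p: "diff_symbol p"
    "\<And>a. a \<in> NA A \<Longrightarrow> a - int k *s b \<notin> NA A \<Longrightarrow> p a = 0" "p (- b) \<noteq> 0"
    using separating_symbol[OF b] by metis
  define s where "s = r * tpow b * Poly_Mapping.single 0 (inverse (p (- b)))"
  define e where "e = - (int k *s b)"
  define T where "T x = s * (tpow e * diag p x)" for x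
  have e: "tpow (- b) ^ k = (tpow e :: ('k, 'd) laurent)"
    by (simp add: tpow_power e_def vector_smult_rneg)
  have "s \<in> S"
    unfolding s_def using r f_in K_sub by (intro mult_in) (auto simp: S_def scalars_def)
  then have T_in: "T x \<in> S" if "x \<in> S" for x
  proof -
    have "tpow e * diag p x \<in> S"
      using that p(2) unfolding S_def e_def by (intro shifted_diag_preserves_toric_algebra) auto
    then show ?thesis unfolding T_def using \<open>s \<in> S\<close> mult_in by blast
  qed
  have T_add: "T (x + y) = T x + T y" for x y by (simp add: T_def diag_add distrib_left)
  have T_scalar: "T (c * x) = c * T x" if "c \<in> scalars" for c x
  proof -
    obtain t where t: "c = Poly_Mapping.single 0 t" using \<open>c \<in> scalars\<close> by (auto simp: scalars_def)
    have "diag p (c * x) = c * diag p x"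
      unfolding t diag_const[symmetric] diag_diag by (simp only: mult.commute)
    then show ?thesis by (simp add: T_def ac_simps)
  qed
  obtain i where "order_below UNIV UNIV i (diag p)" using p(1) unfolding diff_symbol_def by blast
  then have "order_below UNIV UNIV (Suc 0 + i) (\<lambda>x. s * tpow e * diag p x)"
    by (intro order_below_compose order_below_mult) (auto simp: additive_endo_UNIV diag_add distrib_left)
  then have T_order: "order_below R M (Suc i) T" for R M
    using order_below_subset[of UNIV UNIV _ _ R M] by (simp only: T_def[abs_def] mult.assoc plus_nat.simps subset_UNIV)
  define P where "P = restrict T S"
  have "P \<in> Hom_on scalars S"
    using T_in T_add T_scalar add_in mult_in K_sub by (intro Hom_onI) (auto simp: P_def)
  moreover have "order_below S S (Suc i) P"
    using order_below_cong[of S S P T "Suc i"] T_order mult_in unfolding P_def by simp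
  ultimately have P: "P \<in> diff_ops scalars S" using diff_ops_iff by blast
  have "tpow (- b) = 1 * tpow (- b) ^ 1" by simp
  then have "tpow (- b) \<in> localization S (tpow (- b))"
    using one_in unfolding localization_def by blast
  then have "loc_action scalars S (tpow (- b)) P (tpow (- b)) = T (tpow (- b))"
    by (intro loc_action_eq[OF P T_order]) (simp_all add: P_def)
  also have "\<dots> = r * tpow (- b) ^ k"
  proof -
    have "diag p (tpow (- b)) = Poly_Mapping.single 0 (p (- b)) * tpow (- b)"
      by (simp add: tpow_def diag_single mult_single)
    then have "T (tpow (- b)) = r * tpow e * (tpow b * tpow (- b)) *
        (Poly_Mapping.single 0 (inverse (p (- b))) * Poly_Mapping.single 0 (p (- b)))"
      by (simp only: T_def s_def ac_simps)
    also have "\<dots> = r * tpow e"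
      using p(3) by (simp add: tpow_inverse mult_single)
    finally show ?thesis unfolding e .
  qed
  finally show ?thesis using P unfolding S_def by blast
qed

theorem theorem3p1:
  fixes A :: "int ^ 'n ^ 'd"
    and b :: "int ^ 'd"
    and S :: "('k::{alg_closed_field, field_char_0}, 'd) laurent set"
  assumes "ZA A = UNIV"
    and "b \<in> NA A"
    and "S = toric_algebra A"
  shows "localization S (tpow (- b)) =
    {loc_action scalars S (tpow (- b)) P (tpow (- b)) | P. P \<in> diff_ops scalars S}"
proof (intro equalityI subsetI)
  fix u assume "u \<in> localization S (tpow (- b))"
  then obtain r k where "r \<in> S" "u = r * tpow (- b) ^ k" unfolding localization_def by blast
  then show "u \<in> {loc_action scalars S (tpow (- b)) P (tpow (- b)) | P. P \<in> diff_ops scalars S}"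
    using fraction_in_orbit[OF assms(2), of r k] unfolding assms(3) by (metis (mono_tags, lifting) mem_Collect_eq)
next
  interpret localized_algebra scalars S "tpow b" "tpow (- b)"
    unfolding assms(3) using assms(2) by (rule localized_algebra_toric)
  have "tpow (- b) = 1 * tpow (- b) ^ 1" by simp
  then have "tpow (- b) \<in> localization S (tpow (- b))"
    using one_in unfolding localization_def by blast
  moreover fix u
  assume "u \<in> {loc_action scalars S (tpow (- b)) P (tpow (- b)) | P. P \<in> diff_ops scalars S}"
  ultimately show "u \<in> localization S (tpow (- b))" using loc_action_in by blast
qed

end
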